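(* Let $M,N\ge 2$ and $\mathbf A\in\mathbb C^{M\times N}$ with $\operatorname{rank}(\mathbf A)\ge 1$. For $z\in\mathbb C$ define $$F(z):=\mathbf z_M(z)^*\,\mathbf A\,\overline{\mathbf z_N(z)},\qquad F_1(z):=\mathbf z_M(z)^*\,\mathbf J_M\mathbf A\mathbf J_N\,\overline{\mathbf z_N(z)},$$ and let $M_0:=\max_{|z|\le 1}|F(z)|$, $M_1:=\max_{|z|\le1}|F_1(z)|$. Then the optimal rank-1 Hankel approximation of $\mathbf A$ in the Frobenius norm (i.e. a minimizer of $\|\mathbf A-\mathbf H\|_F$ over all Hankel matrices $\mathbf H\in\mathbb C^{M\times N}$ of rank at most $1$) is $\mathbf H_1=\tilde c\,\mathbf z_M(\tilde z)\mathbf z_N(\tilde z)^T$, determined by $$\tilde z\in\begin{cases}\mathop{\mathrm{argmax}}_{|z|\le1}|F(z)| & \text{if } M_0\ge M_1,\\[2pt] \bigl(\mathop{\mathrm{argmax}}_{|z|<1}|F_1(z)|\bigr)^{-1}& \text{if } M_1>M_0,\end{cases}\qquad \tilde c:=\mathbf z_M(\tilde z)^*\,\mathbf A\,\overline{\mathbf z_N(\tilde z)},$$ where $S^{-1}:=\{1/z: z\in S\}$ with the conventions $1/0=\infty$ and $\mathbf z_n(\infty):=\mathbf e_n$.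
   Context: For $z\in\mathbb C$ and $n\in\mathbb N$, $\mathbf z_n(z):=\bigl(\sum_{k=0}^{n-1}|z|^{2k}\bigr)^{-1/2}(1,z,z^2,\dots,z^{n-1})^T\in\mathbb C^n$; $\mathbf e_n:=(0,\dots,0,1)^T\in\mathbb C^n$. $\mathbf J_n$ is the $n\times n$ counteridentity (ones on the antidiagonal, zeros elsewhere). A matrix $\mathbf H\in\mathbb C^{M\times N}$ is Hankel if $\mathbf H=(h_{k+\ell})_{k,\ell=0}^{M-1,N-1}$ for some numbers $h_0,\dots,h_{M+N-2}\in\mathbb C$. $\overline{\,\cdot\,}$ is entrywise complex conjugation, $\mathbf x^*=\overline{\mathbf x}^T$, and $\|\cdot\|_F$ is the Frobenius norm. *)

theory Defs
  imports
    Complex_Main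
    "Jordan_Normal_Form.DL_Rank"
    "Jordan_Normal_Form.Conjugate"
begin

definition zvec :: "nat \<Rightarrow> complex \<Rightarrow> complex vec" where
  "zvec n z = complex_of_real ((\<Sum>k<n. cmod z ^ (2 * k)) powr (- 1 / 2)) \<cdot>\<^sub>v vec n (\<lambda>k. z ^ k)"

text \<open>Points of the extended plane are modelled by \<^typ>\<open>complex option\<close>, with \<^term>\<open>None\<close>
  as the point at infinity, where the normalized vector is \<open>(0, \<dots>, 0, 1)\<close>.\<close>

fun zvec_ext :: "nat \<Rightarrow> complex option \<Rightarrow> complex vec" where
  "zvec_ext n (Some z) = zvec n z"
| "zvec_ext n None = unit_vec n (n - 1)"

definition inverse_ext :: "complex \<Rightarrow> complex option" where
  "inverse_ext z = (if z = 0 then None else Some (1 / z))"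

definition counteridentity :: "nat \<Rightarrow> complex mat" where
  "counteridentity n = mat n n (\<lambda>(i, j). if i + j + 1 = n then 1 else 0)"

text \<open>Only the values \<open>h 0, \<dots>, h (M + N - 2)\<close> of the sequence \<open>h\<close> matter.\<close>

definition hankel :: "nat \<Rightarrow> nat \<Rightarrow> complex mat \<Rightarrow> bool" where
  "hankel M N H \<longleftrightarrow> (\<exists>h :: nat \<Rightarrow> complex. H = mat M N (\<lambda>(k, l). h (k + l)))"

definition frobenius_norm :: "complex mat \<Rightarrow> real" where
  "frobenius_norm A = sqrt (\<Sum>i<dim_row A. \<Sum>j<dim_col A. (cmod (A $$ (i, j)))\<^sup>2)"

text \<open>The matrix \<open>u v\<^sup>T\<close>, without conjugation.\<close>

definition outer_prod :: "complex vec \<Rightarrow> complex vec \<Rightarrow> complex mat" where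
  "outer_prod u v = mat (dim_vec u) (dim_vec v) (\<lambda>(i, j). u $ i * v $ j)"

text \<open>The number \<open>u\<^sup>* A v\<close>; the library's scalar product does not conjugate.\<close>

definition sesq_form :: "complex vec \<Rightarrow> complex mat \<Rightarrow> complex vec \<Rightarrow> complex" where
  "sesq_form u A v = conjugate u \<bullet> (A *\<^sub>v v)"

end

(* For unit vectors u, v and b = u^* A conj(v), completing the square gives
   |A - a u v^T|^2 = |A|^2 - |b|^2 + |a - b|^2 in the Frobenius norm.  A Hankel matrix of rank at
   most 1 has vanishing 2 x 2 minors, which forces its generating sequence to be geometric or
   supported at its last index, so that it is a multiple of z_M(w) z_N(w)^T for a point w of the
   extended plane.  Hence one has to maximise |c w| over the extended plane.  Reversing the
   coordinates of z_n(z) yields z_n(1/z) up to a phase, so that |F_1(z)| = |c(1/z)|, and the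
   maximum over the exterior of the disc is a maximum over the disc.  On the unit circle F and F_1
   have the same set of absolute values; if M_1 > M_0, the maximum of |F_1| is therefore attained
   in the open disc. *)

theory Submission
  imports "HOL-Analysis.Topology_Euclidean_Space" Defs
begin

unbundle no vec_syntax

section \<open>Distance to rank-one matrices\<close>

text \<open>The sum is the Frobenius inner product of \<open>A\<close> with
  \<open>outer_prod u v\<close>; this is why the second vector enters conjugated.\<close>

lemma sesq_form_sum:
  assumes "A \<in> carrier_mat M N" "u \<in> carrier_vec M" "v \<in> carrier_vec N"
  shows "sesq_form u A (conjugate v) = (\<Sum>i<M. \<Sum>j<N. cnj (u $ i) * A $$ (i, j) * cnj (v $ j))"
proof -
  have "sesq_form u A (conjugate v) =
      (\<Sum>i<M. cnj (u $ i) * (\<Sum>j<N. A $$ (i, j) * cnj (v $ j)))"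
    using assms unfolding sesq_form_def scalar_prod_def
    by (auto simp: scalar_prod_def atLeast0LessThan intro!: sum.cong)
  then show ?thesis by (simp add: sum_distrib_left mult.assoc)
qed

text \<open>For unit vectors, \<open>outer_prod u v\<close> has Frobenius norm 1, so
  \<open>b\<close> is the coefficient of the orthogonal projection of \<open>A\<close> onto its span
  and the identity is Pythagoras. Keeping \<open>a\<close> free covers competitors with any
  coefficient.\<close>

lemma frobenius_norm_rank_one_diff:
  fixes a :: complex
  assumes A: "A \<in> carrier_mat M N" and u: "u \<in> carrier_vec M" and v: "v \<in> carrier_vec N"
    and u1: "(\<Sum>i<M. (cmod (u $ i))\<^sup>2) = 1" and v1: "(\<Sum>j<N. (cmod (v $ j))\<^sup>2) = 1"
    and b: "b = sesq_form u A (conjugate v)"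
  shows "(frobenius_norm (A - a \<cdot>\<^sub>m outer_prod u v))\<^sup>2 =
      (frobenius_norm A)\<^sup>2 - (cmod b)\<^sup>2 + (cmod (a - b))\<^sup>2"
proof -
  have ns: "(cmod (x - y))\<^sup>2 = (cmod x)\<^sup>2 - 2 * Re (cnj y * x) + (cmod y)\<^sup>2" for x y :: complex
    by (simp only: cmod_power2) (simp add: power2_eq_square algebra_simps)
  have ent: "(cmod ((A - a \<cdot>\<^sub>m outer_prod u v) $$ (i, j)))\<^sup>2 =
      (cmod (A $$ (i, j)))\<^sup>2 - 2 * Re (cnj a * (cnj (u $ i) * A $$ (i, j) * cnj (v $ j)))
      + (cmod a)\<^sup>2 * ((cmod (u $ i))\<^sup>2 * (cmod (v $ j))\<^sup>2)" if "i < M" "j < N" for i j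
  proof -
    have "(A - a \<cdot>\<^sub>m outer_prod u v) $$ (i, j) = A $$ (i, j) - a * (u $ i * v $ j)"
      using A u v that by (simp add: outer_prod_def)
    then show ?thesis
      by (simp only: ns) (simp add: norm_mult power_mult_distrib mult_ac)
  qed
  have uv1: "(\<Sum>i<M. \<Sum>j<N. (cmod (u $ i))\<^sup>2 * (cmod (v $ j))\<^sup>2) = 1"
    using u1 v1 by (simp flip: sum_distrib_left)
  have dims: "dim_row (A - a \<cdot>\<^sub>m outer_prod u v) = M" "dim_col (A - a \<cdot>\<^sub>m outer_prod u v) = N"
    using u v by (auto simp: outer_prod_def)
  have "(frobenius_norm (A - a \<cdot>\<^sub>m outer_prod u v))\<^sup>2 =
      (\<Sum>i<M. \<Sum>j<N. (cmod ((A - a \<cdot>\<^sub>m outer_prod u v) $$ (i, j)))\<^sup>2)"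
    unfolding frobenius_norm_def dims by (intro real_sqrt_pow2 sum_nonneg) auto
  also have "\<dots> = (\<Sum>i<M. \<Sum>j<N. (cmod (A $$ (i, j)))\<^sup>2
      - 2 * Re (cnj a * (cnj (u $ i) * A $$ (i, j) * cnj (v $ j)))
      + (cmod a)\<^sup>2 * ((cmod (u $ i))\<^sup>2 * (cmod (v $ j))\<^sup>2))"
    by (intro sum.cong refl ent) auto
  also have "\<dots> = (\<Sum>i<M. \<Sum>j<N. (cmod (A $$ (i, j)))\<^sup>2)
      - 2 * Re (cnj a * (\<Sum>i<M. \<Sum>j<N. cnj (u $ i) * A $$ (i, j) * cnj (v $ j)))
      + (cmod a)\<^sup>2 * (\<Sum>i<M. \<Sum>j<N. (cmod (u $ i))\<^sup>2 * (cmod (v $ j))\<^sup>2)"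
    by (simp only: sum.distrib sum_subtractf sum_distrib_left Re_sum)
  also have "(\<Sum>i<M. \<Sum>j<N. (cmod (A $$ (i, j)))\<^sup>2) = (frobenius_norm A)\<^sup>2"
    using A unfolding frobenius_norm_def by (subst real_sqrt_pow2) (auto intro!: sum_nonneg)
  also have "(\<Sum>i<M. \<Sum>j<N. cnj (u $ i) * A $$ (i, j) * cnj (v $ j)) = b"
    using sesq_form_sum[OF A u v] b by simp
  finally show ?thesis
    unfolding uv1 by (simp only: cmod_power2) (simp add: power2_eq_square algebra_simps)
qed

section \<open>Hankel matrices of rank at most one\<close>

text \<open>A linear relation between the two columns gives a nonzero kernel vector of the 2 x 2
  block, so its determinant vanishes.\<close>

lemma rank_le_1_minor:
  fixes A :: "'a :: field mat"
  assumes A: "A \<in> carrier_mat m n" and rank: "vec_space.rank m A \<le> 1"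
    and "i < m" "k < m" "j < n" "l < n"
  shows "A $$ (i, j) * A $$ (k, l) = A $$ (i, l) * A $$ (k, j)"
proof (cases "col A j = col A l")
  \<comment> \<open>Equal columns collapse to one element of the set of columns, so linear
    dependence of that set would yield no relation between them.\<close>
  case True
  then have "A $$ (r, j) = A $$ (r, l)" if "r < m" for r
    using A assms(5,6) that by (metis carrier_matD index_col)
  with assms show ?thesis by simp
next
  case False
  interpret vec_space "TYPE('a)" m .
  let ?U = "{col A j, col A l}"
  have sub: "?U \<subseteq> set (cols A)"
    using A assms by (auto simp: cols_def)
  have carr: "?U \<subseteq> carrier_vec m"
    using A by auto
  \<comment> \<open>Two distinct independent columns would force rank at least 2.\<close>
  have "lin_dep ?U"
    using rank_ge_card_indpt[OF A sub] rank False by auto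
  then obtain a x where a: "lincomb a ?U = 0\<^sub>v m" "x \<in> ?U" "a x \<noteq> 0"
    using finite_lin_dep[of ?U] carr by (auto simp: module_vec_simps)
  have eq: "a (col A j) * A $$ (r, j) + a (col A l) * A $$ (r, l) = 0" if "r < m" for r
    using lincomb_index[OF that carr, of a] a(1) A that False assms by simp
  define p q where "p = a (col A j)" and "q = a (col A l)"
  have pq: "p \<noteq> 0 \<or> q \<noteq> 0"
    using a by (auto simp: p_def q_def)
  have 1: "p * A $$ (i, j) + q * A $$ (i, l) = 0" and 2: "p * A $$ (k, j) + q * A $$ (k, l) = 0"
    using eq assms by (auto simp: p_def q_def)
  \<comment> \<open>Cramer's rule: both \<open>p * ?d\<close> and \<open>q * ?d\<close> are
    combinations of the two relations, and one of \<open>p\<close>, \<open>q\<close> is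
    nonzero.\<close>
  let ?d = "A $$ (i, j) * A $$ (k, l) - A $$ (i, l) * A $$ (k, j)"
  have "p * ?d = (p * A $$ (i, j) + q * A $$ (i, l)) * A $$ (k, l)
      - (p * A $$ (k, j) + q * A $$ (k, l)) * A $$ (i, l)"
    by (simp add: algebra_simps)
  moreover have "q * ?d = (p * A $$ (k, j) + q * A $$ (k, l)) * A $$ (i, j)
      - (p * A $$ (i, j) + q * A $$ (i, l)) * A $$ (k, j)"
    by (simp add: algebra_simps)
  ultimately have "p * ?d = 0" "q * ?d = 0"
    using 1 2 by simp_all
  then show ?thesis using pq by auto
qed

section \<open>Normalization of the power vectors\<close>

lemma zvec_index: "k < n \<Longrightarrow>
    zvec n z $ k = complex_of_real ((\<Sum>k<n. cmod z ^ (2 * k)) powr (- 1 / 2)) * z ^ k"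
  by (simp add: zvec_def)

lemma zvec_weight_pos:
  assumes "n > 0"
  shows "(\<Sum>k<n. cmod z ^ (2 * k)) > 0"
proof -
  \<comment> \<open>The term for k = 0 equals 1 even at z = 0, since 0 ^ 0 = 1.\<close>
  have "cmod z ^ (2 * 0) \<le> (\<Sum>k<n. cmod z ^ (2 * k))"
    using assms by (intro member_le_sum) auto
  then show ?thesis by simp
qed

lemma zvec_ext_carrier: "zvec_ext n w \<in> carrier_vec n"
  by (cases w) (auto simp: zvec_def)

lemma zvec_ext_norm:
  assumes "n > 0"
  shows "(\<Sum>i<n. (cmod (zvec_ext n w $ i))\<^sup>2) = 1"
proof (cases w)
  case None
  then have "(\<Sum>i<n. (cmod (zvec_ext n w $ i))\<^sup>2) = (\<Sum>i<n. if i = n - 1 then 1 else 0)"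
    by (intro sum.cong) auto
  also have "\<dots> = 1" using assms by simp
  finally show ?thesis .
next
  case (Some z)
  define s where "s = (\<Sum>k<n. cmod z ^ (2 * k))"
  have s: "s > 0" unfolding s_def by (rule zvec_weight_pos[OF assms])
  have "(\<Sum>i<n. (cmod (zvec_ext n w $ i))\<^sup>2) = (\<Sum>i<n. (s powr (- 1 / 2))\<^sup>2 * cmod z ^ (2 * i))"
    using Some
    by (intro sum.cong)
      (auto simp: zvec_index s_def norm_mult norm_power power_mult_distrib power_mult mult.commute)
  also have "\<dots> = (s powr (- 1 / 2))\<^sup>2 * s"
    by (simp add: s_def sum_distrib_left)
  also have "(s powr (- 1 / 2))\<^sup>2 = 1 / s"
    using s by (simp add: power2_eq_square powr_minus_divide flip: powr_add)
  finally show ?thesis using s by simp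
qed

text \<open>The point \<open>w\<close> is the ratio of the geometric sequence if \<open>h 0\<close>
  is nonzero, and infinity otherwise. The zero matrix falls under the second case with
  \<open>a = 0\<close>.\<close>

lemma hankel_rank_le_1:
  assumes M: "M \<ge> 2" and N: "N \<ge> 2" and H: "hankel M N H" "vec_space.rank M H \<le> 1"
  shows "\<exists>a w. H = a \<cdot>\<^sub>m outer_prod (zvec_ext M w) (zvec_ext N w)"
proof -
  obtain h where h: "H = mat M N (\<lambda>(k, l). h (k + l))"
    using H(1) by (auto simp: hankel_def)
  have carr: "H \<in> carrier_mat M N" by (simp add: h)
  have minor: "h (i + j) * h (k + l) = h (i + l) * h (k + j)"
    if "i < M" "k < M" "j < N" "l < N" for i j k l
    using rank_le_1_minor[OF carr H(2) that(1,2,3,4)] that by (simp add: h)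
  show ?thesis
  proof (cases "h 0 = 0")
    case False
    define z where "z = h 1 / h 0"
    \<comment> \<open>The indices below M are read in the first column and those below N in the
      first row; minors through the corner entry \<open>h 0\<close> then reach all other
      indices.\<close>
    have hM: "h i = h 0 * z ^ i" if "i < M" for i
      using that
    proof (induction i)
      case (Suc i)
      have "h 0 * h (Suc i) = h i * h 1"
        using minor[of 0 i 0 1] Suc.prems M N by simp
      then show ?case using Suc False by (simp add: z_def field_simps)
    qed simp
    have hN: "h j = h 0 * z ^ j" if "j < N" for j
      using that
    proof (induction j)
      case (Suc j)
      have "h 0 * h (Suc j) = h j * h 1"
        using minor[of 0 1 0 j] Suc.prems M N by simp
      then show ?case using Suc False by (simp add: z_def field_simps)
    qed simp
    have hMN: "h (i + j) = h 0 * (z ^ i * z ^ j)" if "i < M" "j < N" for i j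
    proof -
      have "h 0 * h (i + j) = h i * h j"
        using minor[of 0 i 0 j] that M N by simp
      also have "\<dots> = h 0 * (h 0 * (z ^ i * z ^ j))"
        using hM[OF that(1)] hN[OF that(2)] by simp
      finally show ?thesis using False by simp
    qed
    define s where "s n = complex_of_real ((\<Sum>k<n. cmod z ^ (2 * k)) powr (- 1 / 2))" for n :: nat
    have s: "s n \<noteq> 0" if "n > 0" for n
      using zvec_weight_pos[OF that, of z] by (auto simp: s_def)
    have zs: "zvec n z $ k = s n * z ^ k" if "k < n" for n k
      using zvec_index[OF that] by (simp add: s_def)
    have dz: "dim_vec (zvec n z) = n" for n by (simp add: zvec_def)
    \<comment> \<open>The coefficient cancels the two normalizing factors.\<close>
    have "H = (h 0 / (s M * s N)) \<cdot>\<^sub>m outer_prod (zvec_ext M (Some z)) (zvec_ext N (Some z))"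
      using s[of M] s[of N] M N
      by (intro eq_matI) (auto simp: h outer_prod_def dz zs hMN)
    then show ?thesis by blast
  next
    case True
    have h0: "h k = 0" if "k < M + N - 2" for k
      using that
    proof (induction k)
      case (Suc k)
      \<comment> \<open>This splits k so that rows i, i + 1 and columns j, j + 1 all exist. The
        minor there has \<open>h k = 0\<close> on its diagonal and \<open>h (Suc k)\<close> twice
        off it, so the square of \<open>h (Suc k)\<close> vanishes.\<close>
      define i where "i = min k (M - 2)"
      define j where "j = k - i"
      have ij: "i + j = k" "Suc i < M" "Suc j < N"
        using Suc.prems M N by (auto simp: i_def j_def)
      have "h (i + j) * h (Suc i + Suc j) = h (i + Suc j) * h (Suc i + j)"
        by (rule minor) (use ij in auto)
      then show ?case using Suc ij by simp
    qed (use True in simp)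
    have "h (i + j) = h (M + N - 2) * (unit_vec M (M - 1) $ i * unit_vec N (N - 1) $ j)"
      if "i < M" "j < N" for i j
    proof (cases "i = M - 1 \<and> j = N - 1")
      case True
      then have "i + j = M + N - 2" using M N by auto
      with True M N show ?thesis by simp
    next
      case False
      then have "i + j < M + N - 2" using that by auto
      with h0 False that show ?thesis by auto
    qed
    then have "H = h (M + N - 2) \<cdot>\<^sub>m outer_prod (zvec_ext M None) (zvec_ext N None)"
      by (intro eq_matI) (auto simp: h outer_prod_def)
    then show ?thesis by blast
  qed
qed

text \<open>With the rank bound that follows, this makes the claimed minimizers admissible.\<close>

lemma hankel_outer_prod_zvec_ext: "hankel M N (a \<cdot>\<^sub>m outer_prod (zvec_ext M w) (zvec_ext N w))"
proof (cases w)
  case None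
  \<comment> \<open>The last antidiagonal consists of the corner entry alone.\<close>
  have *: "(i = M - 1 \<and> j = N - 1) = (i + j = M + N - 2)" if "i < M" "j < N" for i j
    using that by auto
  show ?thesis
    unfolding hankel_def None
    by (rule exI[of _ "\<lambda>k. if k = M + N - 2 then a else 0"], intro eq_matI)
      (auto simp: outer_prod_def unit_vec_def simp flip: *)
next
  case (Some z)
  define s where "s n = complex_of_real ((\<Sum>k<n. cmod z ^ (2 * k)) powr (- 1 / 2))" for n :: nat
  have zs: "zvec n z $ k = s n * z ^ k" if "k < n" for n k
    using zvec_index[OF that] by (simp add: s_def)
  have dz: "dim_vec (zvec n z) = n" for n by (simp add: zvec_def)
  show ?thesis
    unfolding hankel_def Some
    by (rule exI[of _ "\<lambda>k. a * s M * s N * z ^ k"], intro eq_matI)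
      (auto simp: outer_prod_def dz zs power_add)
qed

lemma rank_outer_prod_le_1:
  assumes "u \<in> carrier_vec M"
  shows "vec_space.rank M (a \<cdot>\<^sub>m outer_prod u v) \<le> 1"
  using assms
  by (intro vec_space.rank_le_1_product_entries
      [where nc = "dim_vec v" and f = "\<lambda>i. a * u $ i" and g = "\<lambda>j. v $ j"])
    (auto simp: outer_prod_def)

section \<open>Inversion of the extended plane\<close>

text \<open>For nonzero z, z^(n-1-i) = z^(n-1) (1/z)^i, so the reversed vector is proportional to
  the one at 1/z. At z = 0, reversal carries the first unit vector to the last, the value at
  infinity.\<close>

lemma zvec_ext_inverse_ext:
  assumes "n > 0"
  shows "\<exists>p. cmod p = 1 \<and> (\<forall>i<n. zvec_ext n (inverse_ext z) $ i = p * zvec n z $ (n - Suc i))"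
proof (cases "z = 0")
  case True
  have "(\<Sum>k<n. (0::real) ^ (2 * k)) = (\<Sum>k<n. if k = 0 then 1 else 0)"
    by (intro sum.cong) auto
  then have "(\<Sum>k<n. (0::real) ^ (2 * k)) = 1"
    using assms by simp
  then show ?thesis
    using True assms by (intro exI[of _ 1]) (auto simp: inverse_ext_def zvec_index)
next
  case False
  define s where "s x = complex_of_real ((\<Sum>k<n. cmod x ^ (2 * k)) powr (- 1 / 2))" for x
  have zs: "zvec n x $ k = s x * x ^ k" if "k < n" for x k
    using zvec_index[OF that] by (simp add: s_def)
  \<comment> \<open>The quotient of the two entries at i = 0.\<close>
  define p where "p = s (1 / z) / s z / z ^ (n - 1)"
  have "s z \<noteq> 0"
    using zvec_weight_pos[OF assms, of z] by (auto simp: s_def)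
  then have eq: "zvec_ext n (inverse_ext z) $ i = p * zvec n z $ (n - Suc i)" if "i < n" for i
    using that False power_add[of z i "n - Suc i"]
    by (simp add: inverse_ext_def zs p_def field_simps)
  \<comment> \<open>The modulus of the factor is known because both vectors have norm 1.\<close>
  have "1 = (\<Sum>i<n. (cmod (zvec_ext n (inverse_ext z) $ i))\<^sup>2)"
    using zvec_ext_norm[OF assms] by simp
  also have "\<dots> = (\<Sum>i<n. (cmod p)\<^sup>2 * (cmod (zvec n z $ (n - Suc i)))\<^sup>2)"
    by (intro sum.cong refl) (simp add: eq norm_mult power_mult_distrib)
  also have "\<dots> = (cmod p)\<^sup>2 * (\<Sum>i<n. (cmod (zvec n z $ i))\<^sup>2)"
    by (simp add: sum.nat_diff_reindex[of "\<lambda>i. (cmod (zvec n z $ i))\<^sup>2"] flip: sum_distrib_left)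
  also have "\<dots> = (cmod p)\<^sup>2"
    using zvec_ext_norm[OF assms, of "Some z"] by simp
  finally have "cmod p = 1"
    by (metis norm_ge_zero power2_eq_1_iff neg_0_le_iff_le not_one_le_zero)
  with eq show ?thesis by blast
qed

lemma counteridentity_mult_index:
  assumes "A \<in> carrier_mat M N" "i < M" "j < N"
  shows "(counteridentity M * A * counteridentity N) $$ (i, j) = A $$ (M - Suc i, N - Suc j)"
proof -
  have l: "(counteridentity M * A) $$ (i, k) = A $$ (M - Suc i, k)" if "k < N" for k
  proof -
    have "(counteridentity M * A) $$ (i, k) =
        (\<Sum>l<M. counteridentity M $$ (i, l) * A $$ (l, k))"
      using assms that by (simp add: counteridentity_def scalar_prod_def atLeast0LessThan)
    also have "\<dots> = (\<Sum>l<M. if l = M - Suc i then A $$ (l, k) else 0)"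
      using assms by (intro sum.cong) (auto simp: counteridentity_def)
    finally show ?thesis using assms by simp
  qed
  have "(counteridentity M * A * counteridentity N) $$ (i, j) =
      (\<Sum>k<N. (counteridentity M * A) $$ (i, k) * counteridentity N $$ (k, j))"
    using assms by (simp add: counteridentity_def scalar_prod_def atLeast0LessThan)
  also have "\<dots> = (\<Sum>k<N. if k = N - Suc j then A $$ (M - Suc i, k) else 0)"
    using assms(3) by (intro sum.cong refl) (simp add: l, auto simp: counteridentity_def)
  finally show ?thesis using assms by simp
qed

text \<open>Reversing the rows and columns of \<open>A\<close> amounts to reversing both vectors.
  The resulting phases \<open>p\<close> and \<open>q\<close> disappear only in the modulus.\<close>

lemma sesq_form_counteridentity:
  assumes A: "A \<in> carrier_mat M N" and "M > 0" "N > 0"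
  shows "cmod (sesq_form (zvec M z) (counteridentity M * A * counteridentity N)
      (conjugate (zvec N z))) =
    cmod (sesq_form (zvec_ext M (inverse_ext z)) A (conjugate (zvec_ext N (inverse_ext z))))"
proof -
  obtain p where p: "cmod p = 1"
    "\<And>i. i < M \<Longrightarrow> zvec_ext M (inverse_ext z) $ i = p * zvec M z $ (M - Suc i)"
    using zvec_ext_inverse_ext[OF \<open>M > 0\<close>] by blast
  obtain q where q: "cmod q = 1"
    "\<And>i. i < N \<Longrightarrow> zvec_ext N (inverse_ext z) $ i = q * zvec N z $ (N - Suc i)"
    using zvec_ext_inverse_ext[OF \<open>N > 0\<close>] by blast
  let ?f = "\<lambda>i j. cnj (zvec M z $ i) * A $$ (M - Suc i, N - Suc j) * cnj (zvec N z $ j)"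
  have B: "counteridentity M * A * counteridentity N \<in> carrier_mat M N"
    using A by (auto simp: counteridentity_def)
  have zc: "zvec n z \<in> carrier_vec n" for n
    by (simp add: zvec_def)
  have "sesq_form (zvec_ext M (inverse_ext z)) A (conjugate (zvec_ext N (inverse_ext z))) =
      (\<Sum>i<M. \<Sum>j<N. cnj p * cnj q * ?f (M - Suc i) (N - Suc j))"
    unfolding sesq_form_sum[OF A zvec_ext_carrier zvec_ext_carrier]
    by (intro sum.cong refl) (simp add: p(2) q(2) Suc_diff_Suc mult_ac)
  also have "\<dots> = cnj p * cnj q * (\<Sum>i<M. \<Sum>j<N. ?f (M - Suc i) (N - Suc j))"
    by (simp only: sum_distrib_left)
  also have "(\<Sum>i<M. \<Sum>j<N. ?f (M - Suc i) (N - Suc j)) = (\<Sum>i<M. \<Sum>j<N. ?f (M - Suc i) j)"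
    by (simp only: sum.nat_diff_reindex[of "?f i" N for i])
  also have "\<dots> = (\<Sum>i<M. \<Sum>j<N. ?f i j)"
    by (rule sum.nat_diff_reindex[of "\<lambda>i. \<Sum>j<N. ?f i j"])
  also have "\<dots> = sesq_form (zvec M z) (counteridentity M * A * counteridentity N)
      (conjugate (zvec N z))"
    unfolding sesq_form_sum[OF B zc zc]
    by (intro sum.cong refl) (simp add: counteridentity_mult_index[OF A])
  finally show ?thesis
    using p(1) q(1) by (simp add: norm_mult)
qed

section \<open>Maxima on the unit disc\<close>

lemma continuous_on_sesq_form_zvec:
  assumes A: "A \<in> carrier_mat M N" and "M > 0" "N > 0"
  shows "continuous_on S (\<lambda>z. cmod (sesq_form (zvec M z) A (conjugate (zvec N z))))"
proof -
  have zc: "zvec n z \<in> carrier_vec n" for n z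
    by (simp add: zvec_def)
  have cont: "continuous_on S (\<lambda>z. zvec n z $ k)" if "k < n" for n k
  proof -
    have "(\<Sum>k<n. cmod z ^ (2 * k)) \<noteq> 0" for z
      using zvec_weight_pos[of n z] that by simp
    then show ?thesis
      unfolding zvec_index[OF that] by (intro continuous_intros) auto
  qed
  show ?thesis
    unfolding sesq_form_sum[OF A zc zc] by (intro continuous_intros cont) auto
qed

lemma is_arg_max_on_disc:
  fixes f :: "complex \<Rightarrow> real"
  assumes "continuous_on (cball 0 1) f"
  shows "\<exists>z. is_arg_max f (\<lambda>z. cmod z \<le> 1) z"
proof -
  obtain x where "x \<in> cball 0 1" "\<forall>y\<in>cball 0 1. f y \<le> f x"
    using continuous_attains_sup[of "cball 0 1" f] assms by auto
  then show ?thesis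
    by (auto simp: is_arg_max_linorder intro!: exI[of _ x])
qed

text \<open>An attained maximum is what gives \<open>GREATEST\<close> over the reals a
  meaning.\<close>

lemma Greatest_is_arg_max:
  fixes f :: "'a \<Rightarrow> real"
  assumes "is_arg_max f P z"
  shows "(GREATEST r. \<exists>z. P z \<and> r = f z) = f z"
  using assms by (intro Greatest_equality) (auto simp: is_arg_max_linorder)

text \<open>The two existence claims certify that \<open>M0\<close> and \<open>M1\<close> are
  genuine maxima, and \<open>Z \<noteq> {}\<close> that the optimality claim is not vacuous.\<close>

theorem theorem3p4:
  fixes M N :: nat and A :: "complex mat"
    and F F1 :: "complex \<Rightarrow> complex" and M0 M1 :: real
    and Z :: "complex option set" and c :: "complex option \<Rightarrow> complex"
  assumes "M \<ge> 2" and "N \<ge> 2"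
    and "A \<in> carrier_mat M N"
    and "vec_space.rank M A \<ge> 1"
    and F_def: "\<And>z. F z = sesq_form (zvec M z) A (conjugate (zvec N z))"
    and F1_def: "\<And>z. F1 z = sesq_form (zvec M z)
                  (counteridentity M * A * counteridentity N) (conjugate (zvec N z))"
    and M0_def: "M0 = (GREATEST r. \<exists>z. cmod z \<le> 1 \<and> r = cmod (F z))"
    and M1_def: "M1 = (GREATEST r. \<exists>z. cmod z \<le> 1 \<and> r = cmod (F1 z))"
    and Z_def: "Z = (if M0 \<ge> M1
                     then Some ` {z. is_arg_max (\<lambda>z. cmod (F z)) (\<lambda>z. cmod z \<le> 1) z}
                     else inverse_ext ` {z. is_arg_max (\<lambda>z. cmod (F1 z)) (\<lambda>z. cmod z < 1) z})"
    and c_def: "\<And>w. c w = sesq_form (zvec_ext M w) A (conjugate (zvec_ext N w))"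
  shows "(\<exists>z. is_arg_max (\<lambda>z. cmod (F z)) (\<lambda>z. cmod z \<le> 1) z)
       \<and> (\<exists>z. is_arg_max (\<lambda>z. cmod (F1 z)) (\<lambda>z. cmod z \<le> 1) z)
       \<and> Z \<noteq> {}
       \<and> (\<forall>w \<in> Z. is_arg_min (\<lambda>H. frobenius_norm (A - H))
                    (\<lambda>H. hankel M N H \<and> vec_space.rank M H \<le> 1)
                    (c w \<cdot>\<^sub>m outer_prod (zvec_ext M w) (zvec_ext N w)))"
proof -
  have A: "A \<in> carrier_mat M N" by fact
  have pos: "M > 0" "N > 0" using assms(1,2) by auto
  have B: "counteridentity M * A * counteridentity N \<in> carrier_mat M N"
    using A by (auto simp: counteridentity_def)
  have F_c: "F z = c (Some z)" for z
    by (simp add: F_def c_def)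
  have F1_c: "cmod (F1 z) = cmod (c (inverse_ext z))" for z
    using sesq_form_counteridentity[OF A pos] by (simp add: F1_def c_def)
  have ex: "\<exists>z. is_arg_max (\<lambda>z. cmod (F z)) (\<lambda>z. cmod z \<le> 1) z"
    unfolding F_def by (intro is_arg_max_on_disc continuous_on_sesq_form_zvec A pos)
  have ex1: "\<exists>z. is_arg_max (\<lambda>z. cmod (F1 z)) (\<lambda>z. cmod z \<le> 1) z"
    unfolding F1_def by (intro is_arg_max_on_disc continuous_on_sesq_form_zvec B pos)
  have M0: "is_arg_max (\<lambda>z. cmod (F z)) (\<lambda>z. cmod z \<le> 1) z \<Longrightarrow> cmod (F z) = M0" for z
    unfolding M0_def by (rule Greatest_is_arg_max[symmetric])
  have M1: "is_arg_max (\<lambda>z. cmod (F1 z)) (\<lambda>z. cmod z \<le> 1) z \<Longrightarrow> cmod (F1 z) = M1" for z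
    unfolding M1_def by (rule Greatest_is_arg_max[symmetric])
  have le0: "cmod (F z) \<le> M0" if "cmod z \<le> 1" for z
    using ex M0 that by (force simp: is_arg_max_linorder)
  have le1: "cmod (F1 z) \<le> M1" if "cmod z \<le> 1" for z
    using ex1 M1 that by (force simp: is_arg_max_linorder)
  \<comment> \<open>The closed unit disc and its image under inversion cover the extended plane;
    infinity is the image of 0.\<close>
  have c_le: "cmod (c w) \<le> max M0 M1" for w
  proof (cases w)
    case None
    then have "cmod (c w) = cmod (F1 0)" by (simp add: F1_c inverse_ext_def)
    then show ?thesis using le1[of 0] by simp
  next
    case (Some y)
    show ?thesis
    proof (cases "cmod y \<le> 1")
      case True
      then show ?thesis using le0[of y] Some by (simp add: F_c)
    next
      case False
      then have "y \<noteq> 0" by auto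
      then have "inverse_ext (1 / y) = w" using Some by (simp add: inverse_ext_def)
      then have "cmod (c w) = cmod (F1 (1 / y))" by (simp add: F1_c)
      also have "\<dots> \<le> M1"
        using False by (intro le1) (simp add: norm_divide divide_le_eq)
      finally show ?thesis by simp
    qed
  qed
  have interior: "cmod z < 1"
    if M: "M1 > M0" and z: "is_arg_max (\<lambda>z. cmod (F1 z)) (\<lambda>z. cmod z \<le> 1) z" for z
  proof (rule ccontr)
    assume "\<not> cmod z < 1"
    then have "cmod z = 1" using z by (simp add: is_arg_max_def)
    then have "cmod (F1 z) = cmod (F (1 / z))"
      by (auto simp: F1_c F_c inverse_ext_def)
    also have "\<dots> \<le> M0"
      using \<open>cmod z = 1\<close> by (intro le0) (simp add: norm_divide)
    finally show False using M M1[OF z] by simp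
  qed
  \<comment> \<open>A maximizer over the closed disc that lies in the open disc is also a maximizer
    there, with the same value \<open>M1\<close>.\<close>
  have ex_open: "\<exists>z. is_arg_max (\<lambda>z. cmod (F1 z)) (\<lambda>z. cmod z < 1) z \<and> cmod (F1 z) = M1"
    if "M1 > M0"
    using ex1 interior[OF that] M1 unfolding is_arg_max_linorder by (meson less_imp_le)
  have "Z \<noteq> {}"
    using ex ex_open by (auto simp: Z_def)
  moreover have c_Z: "cmod (c w) = max M0 M1" if w: "w \<in> Z" for w
  proof (cases "M0 \<ge> M1")
    case True
    then show ?thesis using w M0 by (auto simp: Z_def F_c[symmetric])
  next
    case False
    then obtain z where z: "w = inverse_ext z"
      "is_arg_max (\<lambda>z. cmod (F1 z)) (\<lambda>z. cmod z < 1) z"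
      using w by (auto simp: Z_def)
    moreover obtain x where "is_arg_max (\<lambda>z. cmod (F1 z)) (\<lambda>z. cmod z < 1) x" "cmod (F1 x) = M1"
      using ex_open False by auto
    ultimately have "cmod (F1 z) = M1"
      unfolding is_arg_max_linorder by (metis order.antisym)
    then show ?thesis using z False by (simp add: F1_c)
  qed
  have dist: "(frobenius_norm (A - a \<cdot>\<^sub>m outer_prod (zvec_ext M w) (zvec_ext N w)))\<^sup>2 =
      (frobenius_norm A)\<^sup>2 - (cmod (c w))\<^sup>2 + (cmod (a - c w))\<^sup>2" for a w
    by (rule frobenius_norm_rank_one_diff[OF A zvec_ext_carrier zvec_ext_carrier
          zvec_ext_norm[OF pos(1)] zvec_ext_norm[OF pos(2)] c_def])
  have "is_arg_min (\<lambda>H. frobenius_norm (A - H)) (\<lambda>H. hankel M N H \<and> vec_space.rank M H \<le> 1)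
      (c w \<cdot>\<^sub>m outer_prod (zvec_ext M w) (zvec_ext N w))" if "w \<in> Z" for w
    unfolding is_arg_min_linorder
  proof (intro conjI allI impI hankel_outer_prod_zvec_ext rank_outer_prod_le_1 zvec_ext_carrier)
    fix H assume "hankel M N H \<and> vec_space.rank M H \<le> 1"
    then obtain a w' where H: "H = a \<cdot>\<^sub>m outer_prod (zvec_ext M w') (zvec_ext N w')"
      using hankel_rank_le_1 assms(1,2) by blast
    \<comment> \<open>By \<open>dist\<close>, the competitor's error is at least the one with
      \<open>a = c w'\<close>, so comparing the moduli of \<open>c\<close> suffices.\<close>
    have "(cmod (c w'))\<^sup>2 \<le> (cmod (c w))\<^sup>2"
      using c_le[of w'] c_Z[OF that] by (intro power_mono) auto
    then have "(frobenius_norm (A - c w \<cdot>\<^sub>m outer_prod (zvec_ext M w) (zvec_ext N w)))\<^sup>2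
        \<le> (frobenius_norm (A - H))\<^sup>2"
      unfolding H dist diff_self norm_zero zero_power2
      using zero_le_power2[of "cmod (a - c w')"] by linarith
    then show "frobenius_norm (A - c w \<cdot>\<^sub>m outer_prod (zvec_ext M w) (zvec_ext N w))
        \<le> frobenius_norm (A - H)"
      by (rule power2_le_imp_le) (simp add: frobenius_norm_def sum_nonneg)
  qed
  ultimately show ?thesis using ex ex1 by blast
qed

end
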